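(* Let $\Gamma$ be a connected cubic girth-regular graph of girth $3$. Then either $\Gamma$ is isomorphic to the complete graph $K_4$, or $\Gamma$ has signature $(0,1,1)$ and is isomorphic to the truncation of a cubic graph.
   Context: $\Gamma$ is a finite simple graph; cubic means $3$-regular. For a graph of finite girth $g$, a girth cycle is a cycle of length $g$, and $\epsilon(e)$ is the number of girth cycles containing the edge $e$. The signature of a vertex $v$ with incident edges $e_1,\ldots,e_k$ ordered so that $\epsilon(e_1)\le\cdots\le\epsilon(e_k)$ is $(\epsilon(e_1),\ldots,\epsilon(e_k))$; a graph is girth-regular if all vertices have the same signature (the signature of the graph). Here the cubic graph $\Lambda$ being truncated may have parallel edges: it is a triple $(V,E,\partial)$, each edge consisting of two mutually inverse arcs with tails, $\mathrm{out}(u)$ the arcs with tail $u$, $|\mathrm{out}(u)|=3$. A dihedral scheme is an irreflexive symmetric relation $\leftrightarrow$ on arcs such that (arcs, $\leftrightarrow$) is a $2$-regular simple graph with components exactly the sets $\mathrm{out}(u)$; a cubic graph has a unique one (each $\mathrm{out}(u)$ forms a triangle). The truncation of $\Lambda$ is the simple graph with vertex set the arcs of $\Lambda$, two arcs adjacent iff $s\leftrightarrow t$ or they are mutually inverse. *)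

theory Defs
  imports
    "Graph_Theory.Digraph_Isomorphism"
    "Graph_Theory.Kuratowski"
    "HOL-Library.Extended_Nat"
    "HOL-Library.Multiset"
begin

section \<open>Edges, cycles and girth\<close>

text \<open>
  A finite simple graph is a finite symmetric digraph without loops and parallel arcs
  (locale \<^locale>\<open>graph\<close>).  Its (undirected) edges are two-element sets of vertices.
\<close>

definition edge_of :: "('a, 'b) pre_digraph \<Rightarrow> 'b \<Rightarrow> 'a set" where
  "edge_of G a = {tail G a, head G a}"

definition edges :: "('a, 'b) pre_digraph \<Rightarrow> 'a set set" where
  "edges G = edge_of G ` arcs G"

definition incident_edges :: "('a, 'b) pre_digraph \<Rightarrow> 'a \<Rightarrow> 'a set set" where
  "incident_edges G v = {e \<in> edges G. v \<in> e}"

definition cubic :: "('a, 'b) pre_digraph \<Rightarrow> bool" where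
  "cubic G \<longleftrightarrow> (\<forall>v \<in> verts G. out_degree G v = 3)"

text \<open>
  The predicate \<^const>\<open>pre_digraph.cycle\<close> concerns directed cycles; in a symmetric digraph it
  also holds of the walks \<open>u, v, u\<close>, which are excluded by the bound on the length.
  A cycle of the undirected graph is identified with its set of edges, so that the starting point
  and the direction of traversal are irrelevant; its length is the number of its edges.
\<close>

definition cycles :: "('a, 'b) pre_digraph \<Rightarrow> 'a set set set" where
  "cycles G = {edge_of G ` set p | p. pre_digraph.cycle G p \<and> 3 \<le> length p}"

definition girth :: "('a, 'b) pre_digraph \<Rightarrow> enat" where
  "girth G = (INF C \<in> cycles G. enat (card C))"

definition girth_cycles :: "('a, 'b) pre_digraph \<Rightarrow> 'a set set set" where
  "girth_cycles G = {C \<in> cycles G. enat (card C) = girth G}"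

definition epsilon :: "('a, 'b) pre_digraph \<Rightarrow> 'a set \<Rightarrow> nat" where
  "epsilon G e = card {C \<in> girth_cycles G. e \<in> C}"

definition signature :: "('a, 'b) pre_digraph \<Rightarrow> 'a \<Rightarrow> nat list" where
  "signature G v = sorted_list_of_multiset (image_mset (epsilon G) (mset_set (incident_edges G v)))"

definition has_signature :: "('a, 'b) pre_digraph \<Rightarrow> nat list \<Rightarrow> bool" where
  "has_signature G \<sigma> \<longleftrightarrow> girth G \<noteq> \<infinity> \<and> (\<forall>v \<in> verts G. signature G v = \<sigma>)"

definition girth_regular :: "('a, 'b) pre_digraph \<Rightarrow> bool" where
  "girth_regular G \<longleftrightarrow> (\<exists>\<sigma>. has_signature G \<sigma>)"

definition complete_graph :: "nat \<Rightarrow> nat pair_pre_digraph" where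
  "complete_graph n = \<lparr> pverts = {..<n}, parcs = {(u, v). u < n \<and> v < n \<and> u \<noteq> v} \<rparr>"

lemma complete_digraph_complete_graph: "complete_digraph n (with_proj (complete_graph n))"
  unfolding complete_digraph_pair_def by (auto simp: complete_graph_def)


section \<open>Truncations\<close>

text \<open>
  A finite loopless graph, possibly with parallel edges, is given by its arcs: \<open>arev\<close> maps every
  arc to its inverse, the edges are the pairs of mutually inverse arcs, and the ends of an edge are
  the tails of its two arcs.
\<close>

definition multigraph :: "('a, 'b) pre_digraph \<Rightarrow> ('b \<Rightarrow> 'b) \<Rightarrow> bool" where
  "multigraph L arev \<longleftrightarrow> fin_digraph L \<and> loopfree_digraph L \<and> bidirected_digraph L arev"

text \<open>
  The graph whose vertices are the arcs of \<open>L\<close> and whose adjacency relation is \<open>R\<close>.  Since \<open>R\<close> is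
  symmetric below, the strongly connected components are the connected components.
\<close>

definition arc_relation_graph :: "('a, 'b) pre_digraph \<Rightarrow> 'b rel \<Rightarrow> 'b pair_pre_digraph" where
  "arc_relation_graph L R = \<lparr> pverts = arcs L, parcs = R \<rparr>"

definition dihedral_scheme :: "('a, 'b) pre_digraph \<Rightarrow> 'b rel \<Rightarrow> bool" where
  "dihedral_scheme L R \<longleftrightarrow>
     R \<subseteq> arcs L \<times> arcs L \<and> irrefl R \<and> sym R \<and>
     (\<forall>a \<in> arcs L. out_degree (with_proj (arc_relation_graph L R)) a = 2) \<and>
     pre_digraph.sccs_verts (with_proj (arc_relation_graph L R)) = out_arcs L ` verts L"

definition truncation ::
    "('a, 'b) pre_digraph \<Rightarrow> ('b \<Rightarrow> 'b) \<Rightarrow> 'b rel \<Rightarrow> 'b pair_pre_digraph" where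
  "truncation L arev R =
     \<lparr> pverts = arcs L,
       parcs = {(s, t). s \<in> arcs L \<and> t \<in> arcs L \<and> ((s, t) \<in> R \<or> t = arev s)} \<rparr>"

text \<open>A cubic graph has exactly one dihedral scheme, so its truncation is well defined.\<close>

lemma dihedral_scheme_cubic_iff:
  fixes L :: "('a, 'b) pre_digraph"
  assumes L: "fin_digraph L" and c: "cubic L"
  shows "dihedral_scheme L R \<longleftrightarrow>
    R = {(s, t). s \<in> arcs L \<and> t \<in> arcs L \<and> s \<noteq> t \<and> tail L s = tail L t}"
    (is "_ \<longleftrightarrow> R = ?T")
proof -
  interpret L: fin_digraph L by (rule L)
  have card3: "card (out_arcs L u) = 3" if "u \<in> verts L" for u
    using c that by (simp add: cubic_def out_degree_def)
  have deg: "out_degree (with_proj (arc_relation_graph L Q)) a = card {t. (a, t) \<in> Q}"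
    for Q :: "'b rel" and a
  proof -
    have "out_arcs (with_proj (arc_relation_graph L Q)) a = Pair a ` {t. (a, t) \<in> Q}"
      by (auto simp: out_arcs_def arc_relation_graph_def)
    then show ?thesis
      by (simp add: out_degree_def card_image inj_on_def)
  qed
  show ?thesis
  proof
    assume D: "dihedral_scheme L R"
    let ?S = "with_proj (arc_relation_graph L R)"
    interpret S: wf_digraph ?S
      using D by unfold_locales (auto simp: arc_relation_graph_def dihedral_scheme_def)
    have sub: "(s, t) \<in> ?T" if "(s, t) \<in> R" for s t
    proof -
      have st: "s \<in> arcs L" "t \<in> arcs L" "s \<noteq> t" "(t, s) \<in> R"
        using D that by (auto simp: dihedral_scheme_def irrefl_on_def dest: symD)
      have "out_arcs L (tail L s) \<in> S.sccs_verts"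
        using D st by (auto simp: dihedral_scheme_def)
      moreover have "s \<rightarrow>\<^sup>*\<^bsub>?S\<^esub> t" "t \<rightarrow>\<^sup>*\<^bsub>?S\<^esub> s"
        using that st by (intro S.reachable_adjI; simp add: arc_relation_graph_def)+
      ultimately have "t \<in> out_arcs L (tail L s)"
        using st(1) unfolding S.in_sccs_verts_conv_reachable by auto
      then show ?thesis using st by auto
    qed
    have nb: "{t. (s, t) \<in> R} = {t. (s, t) \<in> ?T}" if s: "s \<in> arcs L" for s
    proof (rule card_subset_eq)
      have eq: "{t. (s, t) \<in> ?T} = out_arcs L (tail L s) - {s}"
        using s by auto
      show "finite {t. (s, t) \<in> ?T}" unfolding eq by auto
      show "{t. (s, t) \<in> R} \<subseteq> {t. (s, t) \<in> ?T}" using sub by blast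
      have "card {t. (s, t) \<in> ?T} = 2"
        unfolding eq using s card3[of "tail L s"] by simp
      moreover have "card {t. (s, t) \<in> R} = 2"
        using D s by (simp add: dihedral_scheme_def deg)
      ultimately show "card {t. (s, t) \<in> R} = card {t. (s, t) \<in> ?T}" by simp
    qed
    show "R = ?T"
    proof (rule antisym)
      show "R \<subseteq> ?T" using sub by auto
      show "?T \<subseteq> R" using nb by blast
    qed
  next
    assume R: "R = ?T"
    let ?S = "with_proj (arc_relation_graph L R)"
    interpret S: wf_digraph ?S
      by unfold_locales (auto simp: arc_relation_graph_def R)
    have reach: "s \<rightarrow>\<^sup>*\<^bsub>?S\<^esub> t \<longleftrightarrow> s \<in> arcs L \<and> t \<in> arcs L \<and> tail L s = tail L t" for s t
    proof
      assume "s \<rightarrow>\<^sup>*\<^bsub>?S\<^esub> t"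
      then show "s \<in> arcs L \<and> t \<in> arcs L \<and> tail L s = tail L t"
        by (induct rule: S.reachable_induct) (auto simp: arc_relation_graph_def R)
    next
      assume A: "s \<in> arcs L \<and> t \<in> arcs L \<and> tail L s = tail L t"
      show "s \<rightarrow>\<^sup>*\<^bsub>?S\<^esub> t"
      proof (cases "s = t")
        case True
        then show ?thesis using A by (intro S.reachable_refl[THEN back_subst[of "\<lambda>x. s \<rightarrow>\<^sup>*\<^bsub>?S\<^esub> x"]]) (simp_all add: arc_relation_graph_def)
      next
        case False
        then have "(s, t) \<in> R" using A by (simp add: R)
        then show ?thesis by (intro S.reachable_adjI) (simp add: arc_relation_graph_def)
      qed
    qed
    have "S.sccs_verts = out_arcs L ` verts L"
    proof (intro set_eqI iffI)
      fix X assume "X \<in> S.sccs_verts"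
      then have X: "X \<noteq> {}" "\<And>u v. u \<in> X \<Longrightarrow> v \<in> X \<Longrightarrow> u \<rightarrow>\<^sup>*\<^bsub>?S\<^esub> v"
        "\<And>u v. u \<in> X \<Longrightarrow> u \<rightarrow>\<^sup>*\<^bsub>?S\<^esub> v \<Longrightarrow> v \<rightarrow>\<^sup>*\<^bsub>?S\<^esub> u \<Longrightarrow> v \<in> X"
        unfolding S.in_sccs_verts_conv_reachable by blast+
      then obtain a where a: "a \<in> X" by auto
      have aL: "a \<in> arcs L" using X(2)[OF a a] by (simp add: reach)
      have "X = out_arcs L (tail L a)"
      proof (intro set_eqI iffI)
        fix b assume "b \<in> X"
        then show "b \<in> out_arcs L (tail L a)" using X(2)[OF a] by (simp add: reach)
      next
        fix b assume "b \<in> out_arcs L (tail L a)"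
        then show "b \<in> X" using X(3)[OF a] aL by (simp add: reach)
      qed
      then show "X \<in> out_arcs L ` verts L" using aL by simp
    next
      fix X assume "X \<in> out_arcs L ` verts L"
      then obtain u where u: "u \<in> verts L" "X = out_arcs L u" by auto
      have "X \<noteq> {}" using card3[OF u(1)] u(2) by auto
      then show "X \<in> S.sccs_verts"
        unfolding S.in_sccs_verts_conv_reachable using u(2) by (auto simp: reach)
    qed
    moreover have "card {t. (s, t) \<in> R} = 2" if s: "s \<in> arcs L" for s
    proof -
      have "{t. (s, t) \<in> R} = out_arcs L (tail L s) - {s}"
        using s by (auto simp: R)
      then show ?thesis using s card3[of "tail L s"] by simp
    qed
    moreover have "R \<subseteq> arcs L \<times> arcs L" "irrefl R" "sym R"
      by (auto simp: R irrefl_on_def sym_on_def)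
    ultimately show "dihedral_scheme L R"
      by (simp add: dihedral_scheme_def deg)
  qed
qed

end

theory Submission
  imports Defs
begin

text \<open>
  In girth \<open>3\<close> the number \<open>\<epsilon>(uv)\<close> is the number of common neighbours of \<open>u\<close> and \<open>v\<close>, so the entries
  of the signature at \<open>v\<close> sum to twice the number of triangles through \<open>v\<close>, which is therefore the
  same for all vertices.  If it is three, the closed neighbourhood of a vertex is a component
  \<open>K\<^sub>4\<close>.  It cannot be two: some neighbour of \<open>v\<close> would then lie in a single triangle.  If it is
  one, the triangles partition the vertices, and contracting them gives the graph whose truncation
  is \<open>\<Gamma>\<close>.
\<close>

unbundle no funcset_syntax

section \<open>Isomorphisms given by vertex maps, and edge sets of cycles\<close>

text \<open>Without parallel arcs an arc is determined by its ends, so the vertex map already fixes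
  the arc map \<open>h\<close>. Both isomorphisms below thus reduce to comparing adjacency.\<close>

lemma (in nomulti_digraph) digraph_iso_with_projI:
  fixes f :: "'a \<Rightarrow> 'c"
  assumes inj: "inj_on f (verts G)"
    and verts: "pverts H = f ` verts G"
    and arcs: "parcs H = (\<lambda>(u, v). (f u, f v)) ` arcs_ends G"
  shows "digraph_iso G (with_proj H)"
proof -
  define h where "h = (\<lambda>a. (f (tail G a), f (head G a)))"
  have "inj_on h (arcs G)"
  proof (rule inj_onI)
    fix a b assume "a \<in> arcs G" "b \<in> arcs G" "h a = h b"
    then show "a = b"
      using inj by (intro no_multi_arcs) (auto simp: h_def arc_to_ends_def dest: inj_onD)
  qed
  moreover have "parcs H = h ` arcs G"
    unfolding arcs arcs_ends_conv h_def by (simp add: image_image)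
  ultimately show ?thesis
    unfolding digraph_iso_def using inj wf_digraph
    by (intro exI[of _ "\<lparr>iso_verts = f, iso_arcs = h, iso_head = snd, iso_tail = fst\<rparr>"])
      (auto simp: digraph_isomorphism_def app_iso_def with_proj_def h_def verts)
qed

text \<open>Since a cycle is recorded as a set of edges, this is what makes the size of that set
  equal to the length of the walk. An edge used twice would be traversed once in each direction,
  which the distinct vertices allow only in a walk \<open>u, v, u\<close>.\<close>

lemma (in wf_digraph) inj_on_edge_of_cycle:
  assumes cyc: "cycle p" and len: "3 \<le> length p"
  shows "distinct p" and "inj_on (edge_of G) (set p)"
proof -
  obtain u where u: "cas u p u" "distinct (tl (awalk_verts u p))" "p \<noteq> []"
    using cyc by (auto simp: cycle_def awalk_def)
  define n where "n = length p"
  have eq: "map (tail G) p @ [head G (last p)] = tail G (hd p) # map (head G) p"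
    using awalk_verts_conv[of u p] awalk_verts_conv'[OF u(1)] u(3) by simp
  have heads: "distinct (map (head G) p)"
    using u awalk_verts_conv'[OF u(1)] by simp
  have closed: "head G (last p) = tail G (hd p)"
    using awhd_if_cas[OF u(1)] awlast_if_cas[OF u(1)] u(3)
    by (simp add: awalk_verts_conv hd_append hd_map)
  \<comment> \<open>In a closed walk the tails are a rotation of the heads, so distinctness passes
    from the heads to the tails.\<close>
  have "mset (map (tail G) p) = mset (map (head G) p)"
    using arg_cong[OF eq, of mset] closed by simp
  then have tails: "distinct (map (tail G) p)"
    using heads mset_eq_imp_distinct_iff by blast
  then show "distinct p" by (simp add: distinct_map)
  \<comment> \<open>The conditional is the successor of \<open>i\<close> modulo
    \<open>n\<close>.\<close>
  have step: "head G (p ! i) = tail G (p ! (if Suc i = n then 0 else Suc i))" if "i < n" for i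
    using arg_cong[OF eq, of "\<lambda>xs. xs ! Suc i"] that closed u(3)
    by (auto simp: nth_append n_def hd_conv_nth split: if_splits)
  have tail_eq: "i = j" if "tail G (p ! i) = tail G (p ! j)" "i < n" "j < n" for i j
    using tails that by (simp add: n_def distinct_conv_nth) metis
  show "inj_on (edge_of G) (set p)"
  proof (rule inj_onI)
    fix a b assume "a \<in> set p" "b \<in> set p" and e: "edge_of G a = edge_of G b"
    then obtain i j where ij: "a = p ! i" "b = p ! j" "i < n" "j < n"
      by (auto simp: in_set_conv_nth n_def)
    show "a = b"
    proof (rule ccontr)
      assume "a \<noteq> b"
      then have ne: "i \<noteq> j" using ij by auto
      then have "tail G a \<noteq> tail G b" using tail_eq ij by blast
      then have "head G a = tail G b" "head G b = tail G a"
        using e by (auto simp: edge_of_def doubleton_eq_iff)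
      \<comment> \<open>Tails determine positions, so \<open>i\<close> and \<open>j\<close> are
        cyclic successors of each other. Then \<open>n\<close> divides 2, against
        \<open>3 \<le> n\<close>.\<close>
      then have "(if Suc i = n then 0 else Suc i) = j" "(if Suc j = n then 0 else Suc j) = i"
        using step[of i] step[of j] tail_eq[of "if Suc i = n then 0 else Suc i" j]
          tail_eq[of "if Suc j = n then 0 else Suc j" i] ij by auto
      then have "Suc i = j \<or> Suc i = n \<and> 0 = j" "Suc j = i \<or> Suc j = n \<and> 0 = i"
        by presburger+
      then show False
        using len[folded n_def] ne by arith
    qed
  qed
qed

section \<open>Triangles as girth cycles\<close>

context graph
begin

lemma adj_sym: "u \<rightarrow> v \<Longrightarrow> v \<rightarrow> u"
  using arcs_ends_symmetric[OF sym_arcs] .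

lemma adj_neq: "u \<rightarrow> v \<Longrightarrow> u \<noteq> v"
  using adj_not_same by blast

text \<open>By \<open>inj_on_edge_of_cycle\<close> three edges mean a closed walk of three arcs.
  Conversely, going round a triangle gives such a walk, symmetry supplying the arc back to the
  start.\<close>

lemma three_cycles:
  "{C \<in> cycles G. card C = 3} = {{{u, v}, {v, w}, {u, w}} | u v w. u \<rightarrow> v \<and> v \<rightarrow> w \<and> u \<rightarrow> w}"
proof (intro set_eqI iffI)
  fix C assume "C \<in> {C \<in> cycles G. card C = 3}"
  then obtain p where C: "C = edge_of G ` set p" "card C = 3" and p: "cycle p" "3 \<le> length p"
    by (auto simp: cycles_def)
  have "length p = 3"
    using inj_on_edge_of_cycle[OF p] C by (simp add: card_image distinct_card)
  then obtain a b c where abc: "p = [a, b, c]"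
    by (auto simp: numeral_3_eq_3 length_Suc_conv)
  have arcs: "{a, b, c} \<subseteq> arcs G" "head G a = tail G b" "head G b = tail G c" "head G c = tail G a"
    using p(1) by (auto simp: cycle_def abc awalk_Cons_iff awalk_Nil_iff)
  then have "tail G a \<rightarrow> tail G b" "tail G b \<rightarrow> tail G c" "tail G c \<rightarrow> tail G a"
    by (auto simp: arcs_ends_conv image_iff)
  moreover have "C = {{tail G a, tail G b}, {tail G b, tail G c}, {tail G a, tail G c}}"
    by (auto simp: C abc edge_of_def arcs)
  ultimately show "C \<in> {{{u, v}, {v, w}, {u, w}} | u v w. u \<rightarrow> v \<and> v \<rightarrow> w \<and> u \<rightarrow> w}"
    using adj_sym by blast
next
  fix C assume "C \<in> {{{u, v}, {v, w}, {u, w}} | u v w. u \<rightarrow> v \<and> v \<rightarrow> w \<and> u \<rightarrow> w}"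
  then obtain u v w where C: "C = {{u, v}, {v, w}, {u, w}}" and adj: "u \<rightarrow> v" "v \<rightarrow> w" "w \<rightarrow> u"
    using adj_sym by blast
  obtain a b c where arcs: "a \<in> arcs G" "tail G a = u" "head G a = v"
      "b \<in> arcs G" "tail G b = v" "head G b = w" "c \<in> arcs G" "tail G c = w" "head G c = u"
    using adj by (metis reachableE)
  have ne: "u \<noteq> v" "v \<noteq> w" "w \<noteq> u"
    using adj adj_neq by blast+
  have "cycle [a, b, c]"
    using arcs ne adj_in_verts[OF adj(1)]
    by (auto simp: cycle_def awalk_Cons_iff awalk_Nil_iff)
  moreover have "C = edge_of G ` set [a, b, c]"
    using arcs by (auto simp: C edge_of_def)
  ultimately have "C \<in> cycles G"
    unfolding cycles_def mem_Collect_eq by (intro exI[of _ "[a, b, c]"] conjI) simp_all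
  moreover have "card C = 3"
    using ne by (simp add: C doubleton_eq_iff)
  ultimately show "C \<in> {C \<in> cycles G. card C = 3}" by simp
qed

lemma girth_three_imp_triangle:
  assumes "girth G = 3"
  obtains u v w where "u \<rightarrow> v" "v \<rightarrow> w" "u \<rightarrow> w"
proof -
  \<comment> \<open>With no cycle at all the infimum would be infinite. A cycle exists, so the
    infimum is attained, \<open>enat\<close> being well-ordered.\<close>
  obtain D where "D \<in> cycles G"
    using assms by (fastforce simp: girth_def top_enat_def)
  then have "girth G \<in> (\<lambda>C. enat (card C)) ` cycles G"
    unfolding girth_def by (intro wellorder_InfI[of "enat (card D)"]) auto
  then obtain C where "C \<in> {C \<in> cycles G. card C = 3}"
    using assms by (auto simp: numeral_eq_enat)
  then show ?thesis
    unfolding three_cycles using that by blast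
qed

text \<open>A triangle through the edge is determined by its third vertex, so \<open>?tri\<close> is
  a bijection from the common neighbours to the girth cycles in question.\<close>

lemma epsilon_girth_three:
  assumes girth: "girth G = 3" and uv: "u \<rightarrow> v"
  shows "epsilon G {u, v} = card {w. u \<rightarrow> w \<and> v \<rightarrow> w}"
proof -
  let ?tri = "\<lambda>w. {{u, v}, {v, w}, {u, w}}"
  have gc: "girth_cycles G = {C \<in> cycles G. card C = 3}"
    by (auto simp: girth_cycles_def girth numeral_eq_enat)
  have "{C \<in> girth_cycles G. {u, v} \<in> C} = ?tri ` {w. u \<rightarrow> w \<and> v \<rightarrow> w}"
  proof (intro set_eqI iffI)
    fix C assume "C \<in> {C \<in> girth_cycles G. {u, v} \<in> C}"
    then obtain x y z where C: "C = {{x, y}, {y, z}, {x, z}}" "{u, v} \<in> C"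
        and adj: "x \<rightarrow> y" "y \<rightarrow> z" "x \<rightarrow> z"
      unfolding gc three_cycles by blast
    have adj': "y \<rightarrow> x" "z \<rightarrow> y" "z \<rightarrow> x" using adj adj_sym by blast+
    from C(2) consider "{u, v} = {x, y}" | "{u, v} = {y, z}" | "{u, v} = {x, z}"
      unfolding C(1) by blast
    then show "C \<in> ?tri ` {w. u \<rightarrow> w \<and> v \<rightarrow> w}"
    proof cases
      case 1
      then have "C = ?tri z" "u \<rightarrow> z" "v \<rightarrow> z"
        using adj adj' by (auto simp: C(1) doubleton_eq_iff)
      then show ?thesis by blast
    next
      case 2
      then have "C = ?tri x" "u \<rightarrow> x" "v \<rightarrow> x"
        using adj adj' by (auto simp: C(1) doubleton_eq_iff)
      then show ?thesis by blast
    next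
      case 3
      then have "C = ?tri y" "u \<rightarrow> y" "v \<rightarrow> y"
        using adj adj' by (auto simp: C(1) doubleton_eq_iff)
      then show ?thesis by blast
    qed
  next
    fix C assume "C \<in> ?tri ` {w. u \<rightarrow> w \<and> v \<rightarrow> w}"
    then show "C \<in> {C \<in> girth_cycles G. {u, v} \<in> C}"
      unfolding gc three_cycles using uv by blast
  qed
  moreover have "inj_on ?tri {w. u \<rightarrow> w \<and> v \<rightarrow> w}"
  proof (rule inj_onI)
    fix w z assume "w \<in> {w. u \<rightarrow> w \<and> v \<rightarrow> w}" "z \<in> {w. u \<rightarrow> w \<and> v \<rightarrow> w}" "?tri w = ?tri z"
    \<comment> \<open>The third vertex is recovered as the only vertex of the triangle outside
      \<open>{u, v}\<close>.\<close>
    then have "\<Union> (?tri w) - {u, v} = \<Union> (?tri z) - {u, v}" "w \<notin> {u, v}" "z \<notin> {u, v}"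
      using adj_neq by auto
    then show "w = z" by auto
  qed
  ultimately show ?thesis
    by (simp add: epsilon_def card_image)
qed

section \<open>Neighbourhoods and signatures in cubic graphs\<close>

lemma incident_edges_conv: "incident_edges G v = (\<lambda>x. {v, x}) ` {x. v \<rightarrow> x}"
proof (intro set_eqI iffI)
  fix e assume "e \<in> incident_edges G v"
  then obtain a where a: "a \<in> arcs G" "e = {tail G a, head G a}" "v \<in> e"
    by (auto simp: incident_edges_def edges_def edge_of_def)
  then have "tail G a \<rightarrow> head G a" "head G a \<rightarrow> tail G a"
    by (auto simp: arcs_ends_conv intro: adj_sym[unfolded arcs_ends_conv])
  then show "e \<in> (\<lambda>x. {v, x}) ` {x. v \<rightarrow> x}" using a by auto
next
  fix e assume "e \<in> (\<lambda>x. {v, x}) ` {x. v \<rightarrow> x}"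
  then show "e \<in> incident_edges G v"
    by (auto simp: incident_edges_def edges_def edge_of_def arcs_ends_conv image_iff)
qed

lemma card_neighbours: "card {x. v \<rightarrow> x} = out_degree G v"
proof -
  have "{x. v \<rightarrow> x} = head G ` out_arcs G v"
    by (auto simp: arcs_ends_conv image_iff)
  moreover have "inj_on (head G) (out_arcs G v)"
    using no_multi_arcs by (auto simp: inj_on_def arc_to_ends_def)
  ultimately show ?thesis by (simp add: card_image out_degree_def)
qed

lemma cubic_neighboursE:
  assumes "cubic G" "v \<in> verts G"
  obtains x y z where "{x. v \<rightarrow> x} = {x, y, z}" "x \<noteq> y" "x \<noteq> z" "y \<noteq> z"
  using assms card_neighbours[of v] by (auto simp: cubic_def card_3_iff)

lemma cubic_third_neighbourE:
  assumes "cubic G" "v \<in> verts G"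
  obtains w where "v \<rightarrow> w" "w \<noteq> x" "w \<noteq> y"
proof -
  have "card {w. v \<rightarrow> w} = 3"
    using assms by (simp add: card_neighbours cubic_def)
  moreover have "card {x, y} \<le> 2"
    by (simp add: card_insert_if)
  ultimately have "\<not> {w. v \<rightarrow> w} \<subseteq> {x, y}"
    using card_mono[of "{x, y}" "{w. v \<rightarrow> w}"] by auto
  then show ?thesis using that by blast
qed

text \<open>A common neighbour of \<open>v\<close> and \<open>x\<close> is one of the other two
  neighbours of \<open>v\<close>, so each entry is read off from the edges among \<open>x\<close>,
  \<open>y\<close>, \<open>z\<close>.\<close>

lemma signature_girth_three:
  assumes girth: "girth G = 3"
    and nb: "{x. v \<rightarrow> x} = {x, y, z}" and ne: "x \<noteq> y" "x \<noteq> z" "y \<noteq> z"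
  shows "signature G v = sort [of_bool (x \<rightarrow> y) + of_bool (x \<rightarrow> z),
    of_bool (x \<rightarrow> y) + of_bool (y \<rightarrow> z), of_bool (x \<rightarrow> z) + of_bool (y \<rightarrow> z)]"
proof -
  have adj: "v \<rightarrow> x" "v \<rightarrow> y" "v \<rightarrow> z" and nb': "\<And>w. v \<rightarrow> w \<longleftrightarrow> w = x \<or> w = y \<or> w = z"
    using nb by auto
  \<comment> \<open>Stated for an arbitrary arrangement of the neighbours, to serve all three edges
    at \<open>v\<close>; \<open>b \<noteq> c\<close> keeps the two indicators from counting the same
    vertex.\<close>
  have eps: "epsilon G {v, a} = of_bool (a \<rightarrow> b) + of_bool (a \<rightarrow> c)"
    if "{x, y, z} = {a, b, c}" "b \<noteq> c" for a b c
  proof -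
    have "a \<in> {x, y, z}" using that by simp
    then have va: "v \<rightarrow> a" using adj by auto
    have "{w. v \<rightarrow> w \<and> a \<rightarrow> w} = {w \<in> {a, b, c}. a \<rightarrow> w}"
      using nb that(1) by auto
    also have "\<dots> = (if a \<rightarrow> b then {b} else {}) \<union> (if a \<rightarrow> c then {c} else {})"
      using adj_neq by auto
    finally show ?thesis
      using that(2) by (simp add: epsilon_girth_three[OF girth va])
  qed
  have "incident_edges G v = {{v, x}, {v, y}, {v, z}}"
    by (simp add: incident_edges_conv nb)
  moreover have "{v, x} \<noteq> {v, y}" "{v, x} \<noteq> {v, z}" "{v, y} \<noteq> {v, z}"
    using ne by (auto simp: doubleton_eq_iff)
  ultimately have "image_mset (epsilon G) (mset_set (incident_edges G v)) =
      {#epsilon G {v, x}, epsilon G {v, y}, epsilon G {v, z}#}"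
    by simp
  moreover have "x \<rightarrow> y \<longleftrightarrow> y \<rightarrow> x" "x \<rightarrow> z \<longleftrightarrow> z \<rightarrow> x" "y \<rightarrow> z \<longleftrightarrow> z \<rightarrow> y"
    using adj_sym by blast+
  ultimately have "image_mset (epsilon G) (mset_set (incident_edges G v)) =
      mset [of_bool (x \<rightarrow> y) + of_bool (x \<rightarrow> z),
        of_bool (x \<rightarrow> y) + of_bool (y \<rightarrow> z), of_bool (x \<rightarrow> z) + of_bool (y \<rightarrow> z)]"
    using eps[of x y z] eps[of y x z] eps[of z x y] ne by (simp add: insert_commute)
  then show ?thesis
    by (simp only: signature_def sorted_list_of_multiset_mset)
qed

text \<open>Every edge among the neighbours contributes to two entries. The sum does not depend on
  the order of the entries, which makes it easier to compare than the sorted list.\<close>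

lemma sum_list_signature_girth_three:
  assumes "girth G = 3"
    and "{x. v \<rightarrow> x} = {x, y, z}" "x \<noteq> y" "x \<noteq> z" "y \<noteq> z"
  shows "sum_list (signature G v) =
    2 * (of_bool (x \<rightarrow> y) + of_bool (x \<rightarrow> z) + of_bool (y \<rightarrow> z))"
proof -
  have sort: "sum_list (sort xs) = sum_list xs" for xs :: "nat list"
    by (metis mset_sort sum_mset_sum_list)
  show ?thesis
    unfolding signature_girth_three[OF assms] sort by simp
qed

lemma cubic_neighbours_eq:
  assumes "cubic G" and adj: "v \<rightarrow> x" "v \<rightarrow> y" "v \<rightarrow> z" and ne: "x \<noteq> y" "x \<noteq> z" "y \<noteq> z"
  shows "{x. v \<rightarrow> x} = {x, y, z}"
proof -
  have "v \<in> verts G" using adj adj_in_verts by blast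
  then have "card {x. v \<rightarrow> x} = 3"
    using assms by (simp add: card_neighbours cubic_def)
  moreover have "card {x, y, z} = 3" using ne by simp
  ultimately show ?thesis
    using adj by (intro card_subset_eq[symmetric]) (auto intro: card_ge_0_finite)
qed

section \<open>A vertex in three or in two triangles\<close>

text \<open>Each of the four vertices has its three neighbours among the other three, so no edge
  leaves the set and connectedness makes it all of \<open>G\<close>.\<close>

lemma connected_cubic_K4:
  assumes conn: "Digraph_Component.connected G" and cubic: "cubic G"
    and adj: "v \<rightarrow> x" "v \<rightarrow> y" "v \<rightarrow> z" "x \<rightarrow> y" "x \<rightarrow> z" "y \<rightarrow> z"
  shows "digraph_iso G (with_proj (complete_graph 4))"
proof -
  have adj': "x \<rightarrow> v" "y \<rightarrow> v" "z \<rightarrow> v" "y \<rightarrow> x" "z \<rightarrow> x" "z \<rightarrow> y"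
    using adj adj_sym by blast+
  have ne: "v \<noteq> x" "v \<noteq> y" "v \<noteq> z" "x \<noteq> y" "x \<noteq> z" "y \<noteq> z"
    using adj adj_neq by blast+
  have "{w. v \<rightarrow> w} = {x, y, z}" "{w. x \<rightarrow> w} = {v, y, z}"
    "{w. y \<rightarrow> w} = {v, x, z}" "{w. z \<rightarrow> w} = {v, x, y}"
    using adj adj' ne by (intro cubic_neighbours_eq[OF cubic]; simp)+
  then have "v \<rightarrow> w \<longleftrightarrow> w \<in> {x, y, z}" "x \<rightarrow> w \<longleftrightarrow> w \<in> {v, y, z}"
    "y \<rightarrow> w \<longleftrightarrow> w \<in> {v, x, z}" "z \<rightarrow> w \<longleftrightarrow> w \<in> {v, x, y}" for w
    by auto
  then have nb: "a \<rightarrow> b \<longleftrightarrow> b \<in> {v, x, y, z} \<and> b \<noteq> a" if "a \<in> {v, x, y, z}" for a b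
    using that ne by auto
  have v: "v \<in> verts G" using adj adj_in_verts by blast
  have "b \<in> {v, x, y, z}" if "v \<rightarrow>\<^sup>* b" for b
    using that by (induct rule: reachable_induct) (use nb in auto)
  \<comment> \<open>Connectedness refers to the symmetric closure, whose reachability is that of
    \<open>G\<close> because \<open>G\<close> is symmetric.\<close>
  moreover have "v \<rightarrow>\<^sup>* b" if "b \<in> verts G" for b
    using conn v that
    by (auto simp: connected_def strongly_connected_def reachable_mk_symmetric_eq[OF sym_arcs])
  moreover have "{v, x, y, z} \<subseteq> verts G"
    using v adj[THEN adj_in_verts(2)] by simp
  ultimately have V: "verts G = {v, x, y, z}"
    by blast
  then have A: "a \<rightarrow> b \<longleftrightarrow> a \<in> verts G \<and> b \<in> verts G \<and> a \<noteq> b" for a b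
    using nb[of a b] adj_in_verts[of a b] by auto
  have "card (verts G) = 4" using ne by (simp add: V)
  \<comment> \<open>Any numbering of the vertices will do, since adjacency is inequality in both
    graphs.\<close>
  then obtain f where f: "bij_betw f (verts G) {0..<4::nat}"
    using ex_bij_betw_finite_nat[OF finite_verts] by auto
  show ?thesis
  proof (rule digraph_iso_with_projI)
    show inj: "inj_on f (verts G)" using f by (rule bij_betw_imp_inj_on)
    have im: "f ` verts G = {..<4}" using f by (auto simp: bij_betw_def)
    then show "pverts (complete_graph 4) = f ` verts G" by (simp add: complete_graph_def)
    have "parcs (complete_graph 4) = {(s, t). s \<in> f ` verts G \<and> t \<in> f ` verts G \<and> s \<noteq> t}"
      by (simp add: complete_graph_def im)
    also have "\<dots> = (\<lambda>(u, v). (f u, f v)) ` {(a, b). a \<in> verts G \<and> b \<in> verts G \<and> a \<noteq> b}"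
      using inj by (force dest: inj_onD)
    also have "{(a, b). a \<in> verts G \<and> b \<in> verts G \<and> a \<noteq> b} = arcs_ends G"
      using A by auto
    finally show "parcs (complete_graph 4) = (\<lambda>(u, v). (f u, f v)) ` arcs_ends G" .
  qed
qed

text \<open>
  The vertex \<open>y\<close> lies in one triangle only, whereas \<open>v\<close> lies in two.
\<close>

lemma signature_two_triangles:
  assumes cubic: "cubic G" and girth: "girth G = 3"
    and adj: "v \<rightarrow> x" "v \<rightarrow> y" "v \<rightarrow> z" "x \<rightarrow> y" "x \<rightarrow> z" and nadj: "\<not> y \<rightarrow> z" and "y \<noteq> z"
  shows "signature G v \<noteq> signature G y"
proof -
  have adj': "x \<rightarrow> v" "y \<rightarrow> v" "z \<rightarrow> v" "y \<rightarrow> x" "z \<rightarrow> x"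
    using adj adj_sym by blast+
  have ne: "v \<noteq> x" "v \<noteq> y" "v \<noteq> z" "x \<noteq> y" "x \<noteq> z" "y \<noteq> z"
    using adj adj_neq assms(9) by blast+
  have nv: "{w. v \<rightarrow> w} = {x, y, z}" and nx: "{w. x \<rightarrow> w} = {v, y, z}"
    using adj adj' ne by (intro cubic_neighbours_eq[OF cubic]; simp)+
  have "y \<in> verts G" using adj adj_in_verts by blast
  then obtain w where w: "y \<rightarrow> w" "w \<noteq> v" "w \<noteq> x"
    by (rule cubic_third_neighbourE[OF cubic])
  have ny: "{w. y \<rightarrow> w} = {v, x, w}"
    using adj' w ne by (intro cubic_neighbours_eq[OF cubic]) auto
  \<comment> \<open>The neighbours of \<open>v\<close> and \<open>x\<close> are all known and
    \<open>w\<close> is not among them, so \<open>v\<close>, \<open>x\<close>, \<open>y\<close> form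
    the only triangle at \<open>y\<close>.\<close>
  have "w \<noteq> y" "w \<noteq> z" using w(1) nadj adj_neq by auto
  then have "\<not> v \<rightarrow> w" "\<not> x \<rightarrow> w" using nv nx w by auto
  then have "sum_list (signature G y) = 2"
    using sum_list_signature_girth_three[OF girth ny] w ne adj by simp
  moreover have "sum_list (signature G v) = 4"
    using sum_list_signature_girth_three[OF girth nv] ne adj nadj by simp
  ultimately show ?thesis by auto
qed

section \<open>Contracting the triangles\<close>

text \<open>
  The contracted graph has the vertices of \<open>G\<close> as arcs and the triangles as vertices, and the
  inverse of \<open>v\<close> is its neighbour \<open>r v\<close> outside the triangle; both are coded by natural numbers
  through an injection \<open>f\<close>, a triangle by its least code.
\<close>

lemma triangle_partition_imp_truncation:
  assumes T: "\<And>v. v \<in> verts G \<Longrightarrow> v \<in> T v \<and> T v \<subseteq> verts G \<and> card (T v) = 3"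
    and T_eq: "\<And>u v. v \<in> verts G \<Longrightarrow> u \<in> T v \<Longrightarrow> T u = T v"
    and nb: "\<And>v. v \<in> verts G \<Longrightarrow> {u. v \<rightarrow> u} = insert (r v) (T v - {v})"
    and r: "\<And>v. v \<in> verts G \<Longrightarrow> r v \<notin> T v"
  shows "\<exists>(L :: (nat, nat) pre_digraph) arev R.
    multigraph L arev \<and> cubic L \<and> dihedral_scheme L R \<and>
    digraph_iso G (with_proj (truncation L arev R))"
proof -
  let ?V = "verts G"
  have T_iff: "T u = T v \<longleftrightarrow> u \<in> T v" if "u \<in> ?V" "v \<in> ?V" for u v
    using that T[of u] T_eq[of v u] by auto
  have rV: "r v \<in> ?V" and vr: "v \<rightarrow> r v" if "v \<in> ?V" for v
    using nb[OF that] adj_in_verts(2)[of v "r v"] by blast+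
  have r_neq: "r v \<noteq> v" if "v \<in> ?V" for v
    using r[OF that] T[OF that] by auto
  \<comment> \<open>The vertex \<open>v\<close> is a neighbour of \<open>r v\<close> outside the
    triangle of \<open>r v\<close>, and \<open>r (r v)\<close> is the only such neighbour.\<close>
  have rr: "r (r v) = v" if "v \<in> ?V" for v
  proof -
    have "v \<in> insert (r (r v)) (T (r v) - {r v})"
      using nb[OF rV[OF that]] adj_sym[OF vr[OF that]] by blast
    moreover have "v \<notin> T (r v)"
      using r[OF that] T_iff[of v "r v"] T_iff[of "r v" v] rV that by auto
    ultimately show ?thesis by auto
  qed
  \<comment> \<open>This is already the adjacency of a truncation: same triangle, or mutually
    inverse.\<close>
  have adj_iff: "u \<rightarrow> v \<longleftrightarrow> u \<noteq> v \<and> T u = T v \<or> v = r u" if "u \<in> ?V" "v \<in> ?V" for u v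
    using nb[OF that(1)] T_iff[OF that(2,1)] by auto

  obtain f :: "'a \<Rightarrow> nat" where inj: "inj_on f ?V"
    using finite_imp_inj_to_nat_seg[OF finite_verts] by blast
  define g where "g = inv_into ?V f"
  have gf [simp]: "g (f v) = v" if "v \<in> ?V" for v
    using that inj by (simp add: g_def)
  have f_eq [simp]: "f u = f v \<longleftrightarrow> u = v" if "u \<in> ?V" "v \<in> ?V" for u v
    using that inj by (auto dest: inj_onD)
  define c where "c = (\<lambda>v. Min (f ` T v))"
  have c_in: "c v \<in> f ` T v" if "v \<in> ?V" for v
  proof -
    have "finite (T v)" "T v \<noteq> {}"
      using T[OF that] finite_subset[OF _ finite_verts] by blast+
    then show ?thesis unfolding c_def by (intro Min_in) auto
  qed
  \<comment> \<open>The least code belongs to a vertex of the triangle, so equal codes give a common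
    vertex, and by \<open>T_eq\<close> the triangles coincide.\<close>
  have c_iff: "c u = c v \<longleftrightarrow> T u = T v" if uv: "u \<in> ?V" "v \<in> ?V" for u v
  proof
    assume eq: "c u = c v"
    obtain a b where ab: "a \<in> T u" "b \<in> T v" "c u = f a" "c v = f b"
      using c_in uv by blast
    then have "a \<in> ?V" "b \<in> ?V" using T uv by blast+
    then have "a = b" using eq ab by simp
    then show "T u = T v" using T_eq[OF uv(1) ab(1)] T_eq[OF uv(2) ab(2)] by simp
  qed (simp add: c_def)

  \<comment> \<open>The arc \<open>f v\<close> leads from the triangle of \<open>v\<close> to that
    of \<open>r v\<close>. Two triangles joined by several edges produce parallel arcs.\<close>
  define L :: "(nat, nat) pre_digraph" where
    "L = \<lparr>verts = c ` ?V, arcs = f ` ?V, tail = \<lambda>a. c (g a), head = \<lambda>a. c (r (g a))\<rparr>"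
  \<comment> \<open>The locale \<open>bidirected_digraph\<close> requires the reversal to move
    exactly the arcs, hence the identity elsewhere.\<close>
  define arev where "arev = (\<lambda>a. if a \<in> f ` ?V then f (r (g a)) else a)"
  \<comment> \<open>The only candidate, by \<open>dihedral_scheme_cubic_iff\<close>.\<close>
  define R where "R = {(s, t). s \<in> arcs L \<and> t \<in> arcs L \<and> s \<noteq> t \<and> tail L s = tail L t}"
  have L_simps [simp]: "verts L = c ` ?V" "arcs L = f ` ?V" "tail L = (\<lambda>a. c (g a))"
      "head L = (\<lambda>a. c (r (g a)))"
    by (simp_all add: L_def)
  interpret L: fin_digraph L
    by unfold_locales (auto simp: rV)
  have c_r: "c v \<noteq> c (r v)" if "v \<in> ?V" for v
    using r[OF that] rV[OF that] T_iff[OF rV[OF that] that] c_iff[OF that rV[OF that]] by auto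
  have "loopfree_digraph L"
    by unfold_locales (auto simp: c_r)
  moreover have "bidirected_digraph L arev"
    by (rule L.bidirected_digraphI) (auto simp: arev_def rV r_neq rr)
  ultimately have "multigraph L arev"
    by (simp add: multigraph_def L.fin_digraph)
  moreover have cubic: "cubic L"
    unfolding cubic_def
  proof
    fix w assume "w \<in> verts L"
    then obtain v where v: "v \<in> ?V" "w = c v" by auto
    \<comment> \<open>The arcs leaving a contracted triangle are its three vertices.\<close>
    have "out_arcs L w = f ` T v"
      using T[OF v(1)] v by (auto simp: out_arcs_def c_iff T_iff)
    moreover have "inj_on f (T v)" using T[OF v(1)] inj inj_on_subset by blast
    ultimately show "out_degree L w = 3"
      using T[OF v(1)] by (simp add: out_degree_def card_image)
  qed
  moreover have "dihedral_scheme L R"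
    using dihedral_scheme_cubic_iff[OF L.fin_digraph cubic] by (simp add: R_def)
  moreover have "digraph_iso G (with_proj (truncation L arev R))"
  proof (rule digraph_iso_with_projI)
    show "inj_on f ?V" by fact
    show "pverts (truncation L arev R) = f ` ?V" by (simp add: truncation_def)
    \<comment> \<open>Equal tails translate into equal triangles by \<open>c_iff\<close>, and
      \<open>arev\<close> into \<open>r\<close>, so this is \<open>adj_iff\<close> carried over by
      \<open>f\<close>.\<close>
    have mem: "(f u, f v) \<in> parcs (truncation L arev R) \<longleftrightarrow> u \<rightarrow> v"
      if "u \<in> ?V" "v \<in> ?V" for u v
      using that by (auto simp: truncation_def R_def arev_def adj_iff c_iff rV)
    show "parcs (truncation L arev R) = (\<lambda>(u, v). (f u, f v)) ` arcs_ends G"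
    proof (intro equalityI subsetI)
      fix p assume p: "p \<in> parcs (truncation L arev R)"
      then obtain u v where uv: "u \<in> ?V" "v \<in> ?V" "p = (f u, f v)"
        by (auto simp: truncation_def)
      then have "(u, v) \<in> arcs_ends G" using p mem by simp
      then show "p \<in> (\<lambda>(u, v). (f u, f v)) ` arcs_ends G"
        using uv by (intro image_eqI[of _ _ "(u, v)"]) simp_all
    next
      fix p assume "p \<in> (\<lambda>(u, v). (f u, f v)) ` arcs_ends G"
      then obtain u v where "u \<rightarrow> v" "p = (f u, f v)" by auto
      then show "p \<in> parcs (truncation L arev R)"
        using mem[of u v] adj_in_verts[of u v] by simp
    qed
  qed
  ultimately show ?thesis by blast
qed

text \<open>Half the sum is the number of edges among the neighbours, so there is exactly one, and
  the names are permuted so that it joins \<open>x\<close> and \<open>y\<close>.\<close>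

lemma one_triangle_neighboursE:
  assumes cubic: "cubic G" and girth: "girth G = 3"
    and sum: "sum_list (signature G v) = 2" and v: "v \<in> verts G"
  obtains x y z where "{x. v \<rightarrow> x} = {x, y, z}" "x \<noteq> y" "x \<noteq> z" "y \<noteq> z"
    "x \<rightarrow> y" "\<not> x \<rightarrow> z" "\<not> y \<rightarrow> z"
proof -
  obtain x y z where nb: "{x. v \<rightarrow> x} = {x, y, z}" and ne: "x \<noteq> y" "x \<noteq> z" "y \<noteq> z"
    using cubic_neighboursE[OF cubic v] .
  have "of_bool (x \<rightarrow> y) + of_bool (x \<rightarrow> z) + of_bool (y \<rightarrow> z) = (1 :: nat)"
    using sum_list_signature_girth_three[OF girth nb ne] sum by simp
  then consider "x \<rightarrow> y" "\<not> x \<rightarrow> z" "\<not> y \<rightarrow> z" | "x \<rightarrow> z" "\<not> x \<rightarrow> y" "\<not> z \<rightarrow> y"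
    | "y \<rightarrow> z" "\<not> y \<rightarrow> x" "\<not> z \<rightarrow> x"
    using adj_sym[of x y] adj_sym[of y x] adj_sym[of x z] adj_sym[of z x] adj_sym[of y z]
      adj_sym[of z y]
    by (auto simp: of_bool_def split: if_splits)
  then show ?thesis
  proof cases
    case 1
    then show ?thesis using that[of x y z] nb ne by (simp add: insert_commute)
  next
    case 2
    then show ?thesis using that[of x z y] nb ne by (simp add: insert_commute)
  next
    case 3
    then show ?thesis using that[of y z x] nb ne by (simp add: insert_commute)
  qed
qed

text \<open>Provides the data for \<open>triangle_partition_imp_truncation\<close>:
  \<open>T v\<close> is the unique triangle at \<open>v\<close>, and \<open>r v\<close> the
  remaining neighbour.\<close>

lemma one_triangle_imp_truncation:
  assumes cubic: "cubic G" and girth: "girth G = 3"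
    and sum: "\<And>v. v \<in> verts G \<Longrightarrow> sum_list (signature G v) = 2"
  shows "\<exists>(L :: (nat, nat) pre_digraph) arev R.
    multigraph L arev \<and> cubic L \<and> dihedral_scheme L R \<and>
    digraph_iso G (with_proj (truncation L arev R))"
proof -
  define triangle where "triangle S \<longleftrightarrow> card S = 3 \<and> (\<forall>a\<in>S. \<forall>b\<in>S. a \<noteq> b \<longrightarrow> a \<rightarrow> b)" for S
  \<comment> \<open>All requirements at \<open>v\<close> in one predicate, so that a single choice
    yields both functions \<open>T\<close> and \<open>r\<close>.\<close>
  define split where "split v S r \<longleftrightarrow> {u. v \<rightarrow> u} = insert r (S - {v}) \<and> r \<notin> S \<and>
      triangle S \<and> v \<in> S \<and> (\<forall>S'. triangle S' \<and> v \<in> S' \<longrightarrow> S' = S)" for v S r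
  have ex: "\<exists>S r. split v S r" if v: "v \<in> verts G" for v
  proof -
    obtain x y z where nb: "{x. v \<rightarrow> x} = {x, y, z}" and ne: "x \<noteq> y" "x \<noteq> z" "y \<noteq> z"
      and adj: "x \<rightarrow> y" "\<not> x \<rightarrow> z" "\<not> y \<rightarrow> z"
      using one_triangle_neighboursE[OF cubic girth sum[OF v] v] .
    have nadj: "\<not> z \<rightarrow> x" "\<not> z \<rightarrow> y" using adj(2,3) adj_sym[of z x] adj_sym[of z y] by auto
    have vadj: "v \<rightarrow> x" "v \<rightarrow> y" "v \<rightarrow> z" using nb by auto
    then have vne: "v \<noteq> x" "v \<noteq> y" "v \<noteq> z" using adj_neq[of v] by auto
    have tri: "triangle {v, x, y}"
      using vadj adj(1) vadj[THEN adj_sym] adj(1)[THEN adj_sym] ne vne by (auto simp: triangle_def)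
    have uniq: "S' = {v, x, y}" if S': "triangle S'" "v \<in> S'" for S'
    proof -
      have c: "card S' = 3" and clique: "\<And>a b. a \<in> S' \<Longrightarrow> b \<in> S' \<Longrightarrow> a \<noteq> b \<Longrightarrow> a \<rightarrow> b"
        using S' by (auto simp: triangle_def)
      have sub: "S' \<subseteq> {v, x, y, z}"
        using clique[OF S'(2)] nb by blast
      \<comment> \<open>A clique containing \<open>z\<close> avoids \<open>x\<close> and
        \<open>y\<close>, which leaves only two possible vertices.\<close>
      have "z \<notin> S'"
      proof
        assume "z \<in> S'"
        then have "S' \<subseteq> {v, z}" using sub clique nadj ne by blast
        then have "card S' \<le> card {v, z}" by (intro card_mono) auto
        then show False using c vne by simp
      qed
      then have "S' \<subseteq> {v, x, y}" using sub by blast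
      then show ?thesis
        using c ne vne by (intro card_subset_eq) auto
    qed
    have "split v {v, x, y} z"
      unfolding split_def
    proof (intro conjI)
      show "{u. v \<rightarrow> u} = insert z ({v, x, y} - {v})"
        using vne unfolding nb by auto
      show "\<forall>S'. triangle S' \<and> v \<in> S' \<longrightarrow> S' = {v, x, y}"
        by (intro allI impI, elim conjE, rule uniq)
    qed (use tri ne vne in auto)
    then show ?thesis by blast
  qed
  then obtain T r where split: "\<And>v. v \<in> verts G \<Longrightarrow> split v (T v) (r v)"
    by metis
  have nb: "{u. v \<rightarrow> u} = insert (r v) (T v - {v})" and r: "r v \<notin> T v"
    and T: "triangle (T v)" "v \<in> T v" and uniq: "\<And>S. triangle S \<Longrightarrow> v \<in> S \<Longrightarrow> S = T v"
    if "v \<in> verts G" for v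
    using split[OF that] by (simp_all add: split_def)
  have sub: "T v \<subseteq> verts G" if "v \<in> verts G" for v
  proof
    fix u assume "u \<in> T v"
    then have "u = v \<or> v \<rightarrow> u" using nb[OF that] by blast
    then show "u \<in> verts G" using that adj_in_verts(2)[of v u] by auto
  qed
  show ?thesis
  proof (rule triangle_partition_imp_truncation)
    fix u v assume v: "v \<in> verts G" and u: "u \<in> T v"
    \<comment> \<open>\<open>T v\<close> is a triangle containing \<open>u\<close>, hence the unique
      one at \<open>u\<close>.\<close>
    show "T u = T v" using uniq[of u "T v"] T(1)[OF v] sub[OF v] u by auto
  next
    fix v assume "v \<in> verts G"
    then show "v \<in> T v \<and> T v \<subseteq> verts G \<and> card (T v) = 3"
      using T[of v] sub[of v] by (simp add: triangle_def)
  qed (fact nb r)+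
qed

end

theorem theorem4p1:
  fixes \<Gamma> :: "('a, 'b) pre_digraph"
  assumes "graph \<Gamma>"
    and "Digraph_Component.connected \<Gamma>"
    and "cubic \<Gamma>"
    and "girth_regular \<Gamma>"
    and "girth \<Gamma> = 3"
  shows "digraph_iso \<Gamma> (with_proj (complete_graph 4)) \<or>
    (has_signature \<Gamma> [0, 1, 1] \<and>
     (\<exists>(\<Lambda> :: (nat, nat) pre_digraph) arev R.
        multigraph \<Lambda> arev \<and> cubic \<Lambda> \<and> dihedral_scheme \<Lambda> R \<and>
        digraph_iso \<Gamma> (with_proj (truncation \<Lambda> arev R))))"
proof -
  interpret graph \<Gamma> by fact
  note cubic = \<open>cubic \<Gamma>\<close> and girth = \<open>girth \<Gamma> = 3\<close>
  obtain \<sigma> where \<sigma>: "\<And>v. v \<in> verts \<Gamma> \<Longrightarrow> signature \<Gamma> v = \<sigma>"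
    using \<open>girth_regular \<Gamma>\<close> by (auto simp: girth_regular_def has_signature_def)
  \<comment> \<open>One vertex of one triangle is enough to inspect, as regularity transfers its
    signature to all vertices.\<close>
  obtain v x y where tri: "v \<rightarrow>\<^bsub>\<Gamma>\<^esub> x" "x \<rightarrow>\<^bsub>\<Gamma>\<^esub> y" "v \<rightarrow>\<^bsub>\<Gamma>\<^esub> y"
    using girth_three_imp_triangle[OF girth] .
  then have v: "v \<in> verts \<Gamma>" and xV: "x \<in> verts \<Gamma>" and yV: "y \<in> verts \<Gamma>"
    using adj_in_verts by blast+
  have xy: "x \<noteq> y" using tri adj_neq by blast
  obtain z where z: "v \<rightarrow>\<^bsub>\<Gamma>\<^esub> z" "z \<noteq> x" "z \<noteq> y"
    using cubic_third_neighbourE[OF cubic v] .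
  have nb: "{w. v \<rightarrow>\<^bsub>\<Gamma>\<^esub> w} = {x, y, z}"
    using tri z xy by (intro cubic_neighbours_eq[OF cubic]) auto
  have yx: "y \<rightarrow>\<^bsub>\<Gamma>\<^esub> x" using tri adj_sym by blast
  \<comment> \<open>Given the triangle on \<open>v\<close>, \<open>x\<close>, \<open>y\<close>, the
    adjacencies of \<open>z\<close> leave three, two, two or one triangles at
    \<open>v\<close>.\<close>
  consider "x \<rightarrow>\<^bsub>\<Gamma>\<^esub> z" "y \<rightarrow>\<^bsub>\<Gamma>\<^esub> z" | "x \<rightarrow>\<^bsub>\<Gamma>\<^esub> z" "\<not> y \<rightarrow>\<^bsub>\<Gamma>\<^esub> z"
    | "\<not> x \<rightarrow>\<^bsub>\<Gamma>\<^esub> z" "y \<rightarrow>\<^bsub>\<Gamma>\<^esub> z" | "\<not> x \<rightarrow>\<^bsub>\<Gamma>\<^esub> z" "\<not> y \<rightarrow>\<^bsub>\<Gamma>\<^esub> z"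
    by blast
  then show ?thesis
  proof cases
    case 1
    then show ?thesis
      using connected_cubic_K4[OF assms(2) cubic tri(1,3) z(1) tri(2)] by blast
  next
    case 2
    then show ?thesis
      using signature_two_triangles[OF cubic girth tri(1,3) z(1) tri(2)] z(3) \<sigma> v yV by metis
  next
    case 3
    \<comment> \<open>The previous case with \<open>x\<close> and \<open>y\<close> exchanged; both
      contradict the constant signature.\<close>
    then show ?thesis
      using signature_two_triangles[OF cubic girth tri(3,1) z(1) yx] z(2) \<sigma> v xV by metis
  next
    case 4
    \<comment> \<open>The edges to \<open>x\<close> and \<open>y\<close> lie in the single triangle,
      the edge to \<open>z\<close> in none.\<close>
    have "\<sigma> = sort [1, 1, 0]"
      using signature_girth_three[OF girth nb] xy z \<sigma>[OF v] tri(2) 4 by simp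
    then have "\<sigma> = [0, 1, 1]" by simp
    then have sig: "signature \<Gamma> u = [0, 1, 1]" if "u \<in> verts \<Gamma>" for u
      using \<sigma>[OF that] by simp
    then have "has_signature \<Gamma> [0, 1, 1]"
      by (simp add: has_signature_def girth)
    moreover have "sum_list (signature \<Gamma> u) = 2" if "u \<in> verts \<Gamma>" for u
      using sig[OF that] by simp
    ultimately show ?thesis
      using one_triangle_imp_truncation[OF cubic girth] by blast
  qed
qed

end
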